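(* For every polynomial $P_n \in \mathcal{L}_n$, that is, for every polynomial $P_n(z) = \sum_{k=0}^n a_k z^k$ with $a_k \in \{-1,1\}$ for all $k = 0,1,\ldots,n$, we have $$\max \left( \max_{t \in \mathbb{R}} \left|P_n(e^{it})\right|^2 - (n+1),\; (n+1) - \min_{t \in \mathbb{R}} \left|P_n(e^{it})\right|^2 \right) \geq \left(\frac{n}{2}\right)^{1/2}.$$
   Context: $\mathcal{L}_n$ denotes the set of Littlewood polynomials of degree $n$, i.e. all polynomials $P_n(z) = \sum_{k=0}^n a_k z^k$ with every coefficient $a_k \in \{-1,1\}$. *)

theory Defs
  imports "HOL-Analysis.Analysis" "HOL-Computational_Algebra.Polynomial"
begin

definition littlewood_polys :: "nat \<Rightarrow> complex poly set" where
  "littlewood_polys n = {P. degree P = n \<and> (\<forall>k\<le>n. coeff P k \<in> {-1, 1})}"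

definition max_norm_sq_circle :: "complex poly \<Rightarrow> real" where
  "max_norm_sq_circle P = (SUP t::real. (cmod (poly P (exp (\<i> * of_real t))))\<^sup>2)"

definition min_norm_sq_circle :: "complex poly \<Rightarrow> real" where
  "min_norm_sq_circle P = (INF t::real. (cmod (poly P (exp (\<i> * of_real t))))\<^sup>2)"

text \<open>The supremum and infimum above are attained, so they are a genuine maximum and minimum.\<close>

lemma compact_circle_values:
  "compact (range (\<lambda>t::real. (cmod (poly P (exp (\<i> * of_real t))))\<^sup>2))"
proof -
  have "range (\<lambda>t::real. (cmod (poly P (exp (\<i> * of_real t))))\<^sup>2)
      = (\<lambda>z. (cmod (poly P z))\<^sup>2) ` sphere 0 1"
    (is "range ?f = ?g ` _")
  proof (intro equalityI subsetI)
    fix y assume "y \<in> range ?f"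
    then show "y \<in> ?g ` sphere 0 1" by (auto simp: norm_exp_i_times)
  next
    fix y assume "y \<in> ?g ` sphere 0 1"
    then obtain z where z: "cmod z = 1" "y = ?g z" by auto
    then have "z \<noteq> 0" by auto
    then have "z = exp (\<i> * of_real (Arg z))"
      using Arg_eq[of z] z by simp
    then have "y = ?f (Arg z)" using z(2) by (rule_tac trans) (assumption, rule arg_cong[where f="?g"])
    then show "y \<in> range ?f" by (rule range_eqI)
  qed
  moreover have "compact (?g ` sphere 0 1)"
    by (intro compact_continuous_image continuous_intros compact_sphere)
  ultimately show ?thesis by simp
qed

lemma max_norm_sq_circle_attained:
  "\<exists>t::real. max_norm_sq_circle P = (cmod (poly P (exp (\<i> * of_real t))))\<^sup>2"
  "(cmod (poly P (exp (\<i> * of_real s))))\<^sup>2 \<le> max_norm_sq_circle P"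
proof -
  let ?V = "range (\<lambda>t::real. (cmod (poly P (exp (\<i> * of_real t))))\<^sup>2)"
  have b: "bdd_above ?V" "closed ?V"
    using compact_circle_values[of P]
    by (auto intro: bounded_imp_bdd_above compact_imp_bounded compact_imp_closed)
  then have "Sup ?V \<in> ?V" by (intro closed_contains_Sup) auto
  then show "\<exists>t::real. max_norm_sq_circle P = (cmod (poly P (exp (\<i> * of_real t))))\<^sup>2"
    unfolding max_norm_sq_circle_def by blast
  show "(cmod (poly P (exp (\<i> * of_real s))))\<^sup>2 \<le> max_norm_sq_circle P"
    unfolding max_norm_sq_circle_def using b by (intro cSUP_upper) auto
qed

lemma min_norm_sq_circle_attained:
  "\<exists>t::real. min_norm_sq_circle P = (cmod (poly P (exp (\<i> * of_real t))))\<^sup>2"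
  "min_norm_sq_circle P \<le> (cmod (poly P (exp (\<i> * of_real s))))\<^sup>2"
proof -
  let ?V = "range (\<lambda>t::real. (cmod (poly P (exp (\<i> * of_real t))))\<^sup>2)"
  have b: "bdd_below ?V" "closed ?V"
    using compact_circle_values[of P]
    by (auto intro: bounded_imp_bdd_below compact_imp_bounded compact_imp_closed)
  then have "Inf ?V \<in> ?V" by (intro closed_contains_Inf) auto
  then show "\<exists>t::real. min_norm_sq_circle P = (cmod (poly P (exp (\<i> * of_real t))))\<^sup>2"
    unfolding min_norm_sq_circle_def by blast
  show "min_norm_sq_circle P \<le> (cmod (poly P (exp (\<i> * of_real s))))\<^sup>2"
    unfolding min_norm_sq_circle_def using b by (intro cINF_lower) auto
qed

end

theory Submission
  imports Defs
begin

text \<open>On the unit circle \<open>\<bar>P z\<bar>\<^sup>2 - (n + 1)\<close> has the same modulus as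
  \<open>Q z = P z * z^n * P (1 / z) - (n + 1) z^n\<close>, a polynomial of degree at most \<open>2 n\<close>. Its coefficient
  at \<open>k\<close> with \<open>k \<noteq> n\<close> is a sum of signs whose number has the parity of \<open>k + 1\<close>, so for even
  \<open>k \<noteq> n\<close> it is an odd integer. There are at least \<open>n\<close> such \<open>k\<close>, and Parseval's identity over the
  roots of unity of order \<open>2 n + 1\<close> yields \<open>\<bar>Q z\<bar>\<^sup>2 \<ge> n\<close> for some \<open>z\<close> on the circle.\<close>

text \<open>The sum is geometric, with ratio \<open>w = cis (2 * pi * (k - l) / N)\<close> and
  \<open>w ^ N = 1\<close>. Equality \<open>w = 1\<close> would make \<open>N\<close> divide
  \<open>k - l\<close>, which for indices below \<open>N\<close> leaves only
  \<open>k = l\<close>.\<close>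

lemma sum_roots_unity_orthogonal:
  fixes N k l :: nat
  assumes "k < N" "l < N"
  shows "(\<Sum>j<N. cis (2 * pi * real j / real N) ^ k * cnj (cis (2 * pi * real j / real N) ^ l))
    = (if k = l then of_nat N else 0)"
proof -
  define w where "w = cis (2 * pi * (real k - real l) / real N)"
  have term_eq: "cis (2 * pi * real j / real N) ^ k * cnj (cis (2 * pi * real j / real N) ^ l) = w ^ j"
    for j
    by (simp add: w_def Complex.DeMoivre cis_cnj cis_mult) (simp add: field_simps diff_divide_distrib)
  show ?thesis
  proof (cases "k = l")
    case True
    then show ?thesis unfolding term_eq by (simp add: w_def)
  next
    case False
    have N: "real N > 0" using assms by simp
    have "w \<noteq> 1"
    proof
      assume "w = 1"
      then have "exp (\<i> * of_real (2 * pi * (real k - real l) / real N)) = 1"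
        by (simp add: w_def cis_conv_exp)
      then obtain m :: int where "2 * pi * (real k - real l) / real N = of_int (2 * m) * pi"
        unfolding exp_eq_1 by auto
      then have "2 * pi * (real k - real l) = 2 * pi * (of_int m * real N)"
        using N by (simp add: field_simps)
      then have "real k - real l = of_int m * real N"
        unfolding mult_cancel_left by simp
      then have "real_of_int (int k - int l) = real_of_int (m * int N)" by simp
      then have eq: "int k - int l = m * int N" using of_int_eq_iff by blast
      have "int N dvd int k - int l" unfolding eq by simp
      moreover have "\<bar>int k - int l\<bar> < int N" using assms by auto
      ultimately show False using False zdvd_not_zless[of "\<bar>int k - int l\<bar>" "int N"] by auto
    qed
    moreover have "w ^ N = 1"
    proof -
      have "w ^ N = cis (2 * pi * of_int (int k - int l))"
        using N by (simp add: w_def Complex.DeMoivre)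
      then show ?thesis by (simp only: cis_multiple_2pi Ints_of_int)
    qed
    ultimately show ?thesis unfolding term_eq using False by (simp add: geometric_sum)
  qed
qed

text \<open>Expand the squared modulus and sum over the roots of unity first: orthogonality keeps
  only the diagonal. The degree bound puts all exponents below \<open>N\<close>, so distinct ones
  stay distinct modulo \<open>N\<close>.\<close>

lemma parseval_roots_unity:
  fixes Q :: "complex poly"
  assumes "degree Q < N"
  shows "(\<Sum>j<N. (cmod (poly Q (cis (2 * pi * real j / real N))))\<^sup>2)
    = real N * (\<Sum>k<N. (cmod (coeff Q k))\<^sup>2)"
proof -
  define z where "z j = cis (2 * pi * real j / real N)" for j :: nat
  have poly_eq: "poly Q x = (\<Sum>k<N. coeff Q k * x ^ k)" for x
  proof -
    have "poly Q x = (\<Sum>k\<le>degree Q. coeff Q k * x ^ k)" by (rule poly_altdef)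
    also have "\<dots> = (\<Sum>k<N. coeff Q k * x ^ k)"
      using assms by (intro sum.mono_neutral_left) (auto simp: coeff_eq_0)
    finally show ?thesis .
  qed
  have "complex_of_real (\<Sum>j<N. (cmod (poly Q (z j)))\<^sup>2) = (\<Sum>j<N. poly Q (z j) * cnj (poly Q (z j)))"
    unfolding of_real_sum complex_norm_square ..
  also have "\<dots> = (\<Sum>j<N. \<Sum>k<N. \<Sum>l<N. coeff Q k * cnj (coeff Q l) * (z j ^ k * cnj (z j ^ l)))"
    by (simp add: poly_eq sum_product mult_ac)
  also have "\<dots> = (\<Sum>k<N. \<Sum>j<N. \<Sum>l<N. coeff Q k * cnj (coeff Q l) * (z j ^ k * cnj (z j ^ l)))"
    by (rule sum.swap)
  also have "\<dots> = (\<Sum>k<N. \<Sum>l<N. coeff Q k * cnj (coeff Q l) * (\<Sum>j<N. z j ^ k * cnj (z j ^ l)))"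
    unfolding sum_distrib_left by (rule sum.cong[OF refl]) (rule sum.swap)
  also have "\<dots> = (\<Sum>k<N. \<Sum>l<N. if k = l then coeff Q k * cnj (coeff Q k) * of_nat N else 0)"
    unfolding z_def by (intro sum.cong refl) (subst sum_roots_unity_orthogonal, auto)
  also have "\<dots> = complex_of_real (real N * (\<Sum>k<N. (cmod (coeff Q k))\<^sup>2))"
    by (simp add: complex_norm_square sum_distrib_left mult_ac del: of_real_power)
  finally show ?thesis unfolding z_def of_real_eq_iff .
qed

text \<open>The coefficient sum is the mean of the squared modulus over the \<open>N\<close>-th
  roots of unity, and not all values can lie below their mean.\<close>

lemma exists_unit_circle_ge_coeff_sum:
  fixes Q :: "complex poly"
  assumes "degree Q < N"
  obtains t :: real where "(\<Sum>k<N. (cmod (coeff Q k))\<^sup>2) \<le> (cmod (poly Q (cis t)))\<^sup>2"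
proof (rule ccontr)
  assume "\<not> thesis"
  then have less: "(cmod (poly Q (cis t)))\<^sup>2 < (\<Sum>k<N. (cmod (coeff Q k))\<^sup>2)" for t
    using that not_le by blast
  have "(\<Sum>j<N. (cmod (poly Q (cis (2 * pi * real j / real N))))\<^sup>2)
      < (\<Sum>j<N. \<Sum>k<N. (cmod (coeff Q k))\<^sup>2)"
    using assms by (intro sum_strict_mono less) auto
  then show False using parseval_roots_unity[OF assms] by simp
qed

lemma sum_signs_eq_of_int:
  fixes f :: "'a \<Rightarrow> 'b::ring_1"
  assumes "finite A" "\<And>i. i \<in> A \<Longrightarrow> f i \<in> {-1, 1}"
  shows "\<exists>m. sum f A = of_int m \<and> (even m \<longleftrightarrow> even (card A))"
  using assms
proof (induction A)
  case empty
  show ?case by (intro exI[of _ 0]) simp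
next
  case (insert x A)
  then obtain m where m: "sum f A = of_int m" "even m \<longleftrightarrow> even (card A)" by auto
  from insert.prems have "f x = of_int (-1) \<or> f x = of_int 1" by auto
  then obtain s :: int where "f x = of_int s" "odd s"
    by (metis even_minus odd_one)
  then show ?case using insert m by (intro exI[of _ "s + m"]) auto
qed

text \<open>An odd number of odd integers has an odd, hence nonzero, sum.\<close>

lemma norm_sum_signs_ge_1:
  fixes f :: "'a \<Rightarrow> complex"
  assumes "odd (card A)" "\<And>i. i \<in> A \<Longrightarrow> f i \<in> {-1, 1}"
  shows "1 \<le> cmod (sum f A)"
proof -
  have "finite A" using assms(1) card.infinite by fastforce
  then obtain m where m: "sum f A = of_int m" "odd m"
    using sum_signs_eq_of_int[of A f] assms by auto
  then have "1 \<le> \<bar>m\<bar>" by presburger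
  then show ?thesis unfolding m by simp
qed

text \<open>On the circle \<open>inverse z = cnj z\<close>, and real coefficients let conjugation
  pass through \<open>P\<close>. Thus \<open>P * reflect_poly P\<close> takes the value
  \<open>z ^ degree P\<close> times the squared modulus of \<open>P\<close> there.\<close>

lemma poly_reflect_poly_unit_circle:
  fixes P :: "complex poly"
  assumes "cmod z = 1" "\<And>k. coeff P k \<in> \<real>"
  shows "poly (reflect_poly P) z = z ^ degree P * cnj (poly P z)"
proof -
  have "z \<noteq> 0" using assms(1) by auto
  moreover have "inverse z = cnj z"
    using divide_conv_cnj[OF assms(1), of 1] by (simp add: inverse_eq_divide)
  moreover have "poly P (cnj z) = cnj (poly P z)"
    using poly_cnj_real[of P z] assms(2) by simp
  ultimately show ?thesis by (simp add: poly_reflect_poly_nz)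
qed

lemma littlewood_coeff_mult_reflect:
  assumes "P \<in> littlewood_polys n" "even k" "k \<le> 2 * n"
  shows "1 \<le> cmod (coeff (P * reflect_poly P) k)"
proof -
  from assms(1) have deg: "degree P = n" and signs: "\<And>i. i \<le> n \<Longrightarrow> coeff P i \<in> {-1, 1}"
    by (auto simp: littlewood_polys_def)
  let ?f = "\<lambda>i. coeff P i * coeff (reflect_poly P) (k - i)"
  have "coeff (P * reflect_poly P) k = (\<Sum>i\<le>k. ?f i)" by (rule coeff_mult)
  \<comment> \<open>Only indices with \<open>i\<close> and \<open>k - i\<close> both at most
    \<open>n\<close> contribute; the truncated difference \<open>k - n\<close> is 0 when
    \<open>k \<le> n\<close>.\<close>
  also have "\<dots> = (\<Sum>i\<in>{k - n..min k n}. ?f i)"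
    by (intro sum.mono_neutral_right) (auto simp: deg coeff_reflect_poly coeff_eq_0)
  finally have eq: "coeff (P * reflect_poly P) k = (\<Sum>i\<in>{k - n..min k n}. ?f i)" .
  show ?thesis unfolding eq
  proof (rule norm_sum_signs_ge_1)
    \<comment> \<open>The range has \<open>k + 1\<close> elements if \<open>k \<le> n\<close> and
      \<open>2 * n - k + 1\<close> otherwise.\<close>
    show "odd (card {k - n..min k n})"
      using assms(2,3) by (cases "k \<le> n") (auto simp: Suc_diff_le)
    fix i assume "i \<in> {k - n..min k n}"
    then have "coeff P i \<in> {-1, 1}" "coeff (reflect_poly P) (k - i) \<in> {-1, 1}"
      using signs[of i] signs[of "n - (k - i)"] by (auto simp: coeff_reflect_poly deg)
    then show "?f i \<in> {-1, 1}" by auto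
  qed
qed

theorem theorem2p2:
  fixes n :: nat and P :: "complex poly"
  assumes "P \<in> littlewood_polys n"
  shows "max (max_norm_sq_circle P - (real n + 1)) ((real n + 1) - min_norm_sq_circle P) \<ge> sqrt (real n / 2)"
proof -
  from assms have deg: "degree P = n" and signs: "\<And>i. i \<le> n \<Longrightarrow> coeff P i \<in> {-1, 1}"
    by (auto simp: littlewood_polys_def)
  have real_coeff: "coeff P i \<in> \<real>" for i
    using signs[of i] by (cases "i \<le> n") (auto simp: coeff_eq_0 deg)
  define Q where "Q = P * reflect_poly P - monom (of_nat (n + 1)) n"
  have "degree (P * reflect_poly P) \<le> 2 * n"
    using degree_mult_le[of P "reflect_poly P"] degree_reflect_poly_le[of P] deg by linarith
  moreover have "degree (monom (of_nat (n + 1) :: complex) n) \<le> 2 * n"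
    using degree_monom_le[of "of_nat (n + 1) :: complex" n] by linarith
  ultimately have "degree Q < 2 * n + 1"
    unfolding Q_def using degree_diff_le by (metis Suc_eq_plus1 less_Suc_eq_le)
  then obtain t where t: "(\<Sum>k<2 * n + 1. (cmod (coeff Q k))\<^sup>2) \<le> (cmod (poly Q (cis t)))\<^sup>2"
    by (rule exists_unit_circle_ge_coeff_sum)
  \<comment> \<open>Of the \<open>n + 1\<close> even indices up to \<open>2 * n\<close>, at most one
    is lost by excluding \<open>n\<close>, the only place where the monomial alters the coefficient
    of the product.\<close>
  define E where "E = (\<lambda>i. 2 * i) ` {..n} - {n}"
  have "card ((\<lambda>i. 2 * i) ` {..n}) = n + 1" by (subst card_image) (auto simp: inj_on_def)
  then have "n \<le> card E" unfolding E_def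
    using diff_card_le_card_Diff[of "{n}" "(\<lambda>i. 2 * i) ` {..n}"] by simp
  have "real n \<le> (\<Sum>k\<in>E. 1)" using \<open>n \<le> card E\<close> by simp
  also have "\<dots> \<le> (\<Sum>k\<in>E. (cmod (coeff Q k))\<^sup>2)"
  proof (rule sum_mono)
    fix k assume "k \<in> E"
    then have "even k" "k \<le> 2 * n" "k \<noteq> n" by (auto simp: E_def)
    then have "1 \<le> cmod (coeff Q k)"
      using littlewood_coeff_mult_reflect[OF assms] by (simp add: Q_def)
    then show "1 \<le> (cmod (coeff Q k))\<^sup>2" by simp
  qed
  also have "\<dots> \<le> (\<Sum>k<2 * n + 1. (cmod (coeff Q k))\<^sup>2)"
    by (rule sum_mono2) (auto simp: E_def)
  also note t
  finally have "real n \<le> (cmod (poly Q (cis t)))\<^sup>2" .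
  then have n_le: "sqrt (real n) \<le> cmod (poly Q (cis t))" by (rule real_le_lsqrt[OF norm_ge_zero])
  define v where "v = (cmod (poly P (cis t)))\<^sup>2"
  have "poly Q (cis t) = cis t ^ n * (poly P (cis t) * cnj (poly P (cis t)) - of_nat (n + 1))"
    by (simp add: Q_def poly_monom poly_reflect_poly_unit_circle[OF _ real_coeff] deg algebra_simps)
  also have "\<dots> = cis t ^ n * of_real (v - (real n + 1))"
    by (simp add: v_def complex_norm_square del: of_real_power)
  finally have "cmod (poly Q (cis t)) = \<bar>v - (real n + 1)\<bar>"
    by (simp only: norm_mult norm_power norm_cis norm_of_real) simp
  moreover have "v \<le> max_norm_sq_circle P" "min_norm_sq_circle P \<le> v"
    using max_norm_sq_circle_attained(2)[of P t] min_norm_sq_circle_attained(2)[of P t]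
    by (simp_all add: v_def cis_conv_exp)
  \<comment> \<open>Depending on the sign of \<open>v - (n + 1)\<close>, its absolute value is
    bounded by the difference with the maximum or by the one with the minimum.\<close>
  ultimately have "sqrt (real n)
      \<le> max (max_norm_sq_circle P - (real n + 1)) ((real n + 1) - min_norm_sq_circle P)"
    using n_le by linarith
  \<comment> \<open>The argument gives the stronger bound \<open>sqrt n\<close>; it is weakened here
    to the stated one.\<close>
  moreover have "sqrt (real n / 2) \<le> sqrt (real n)" by simp
  ultimately show ?thesis by linarith
qed

end
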